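(* A family $\mathcal{T}$ of complete theories contains an approximating subfamily (i.e., a subfamily $\mathcal{T}'\subseteq\mathcal{T}$ such that some theory $T\notin\mathcal{T}'$ is $\mathcal{T}'$-approximated) if and only if $\mathcal{T}$ is infinite.
   Context: All theories are complete first-order theories in relational languages; a theory in a sublanguage of $\Sigma(\mathcal{T})=\bigcup_{T\in\mathcal{T}}\Sigma(T)$ is identified with its expansion to $\Sigma(\mathcal{T})$ in which missing symbols are interpreted as empty predicates. For a class $\mathcal{T}$ and a theory $T\notin\mathcal{T}$, $T$ is $\mathcal{T}$-approximated if for every sentence $\varphi\in T$ there is $T'\in\mathcal{T}$ with $\varphi\in T'$; in this case $\mathcal{T}$ is called an approximating family (for $T$). *)

theory Defs
  imports Main
begin

section \<open>First-order logic in relational languages\<close>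

text \<open>
  A predicate symbol is a name together with its arity, so a relational signature is a set of
  such pairs; arity 0 is allowed. Terms are variables, written as de Bruijn indices.
  The remaining connectives are the usual classical abbreviations.
\<close>

type_synonym 's signature = "('s \<times> nat) set"

datatype 's fm =
    Falsum
  | Eql nat nat
  | Rel 's "nat list"
  | Imp "'s fm" "'s fm"
  | Forall "'s fm"

abbreviation Neg :: "'s fm \<Rightarrow> 's fm" where
  "Neg \<phi> \<equiv> Imp \<phi> Falsum"

primrec free_vars :: "'s fm \<Rightarrow> nat set" where
  "free_vars Falsum = {}"
| "free_vars (Eql x y) = {x, y}"
| "free_vars (Rel R xs) = set xs"
| "free_vars (Imp \<phi> \<psi>) = free_vars \<phi> \<union> free_vars \<psi>"
| "free_vars (Forall \<phi>) = {x. Suc x \<in> free_vars \<phi>}"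

primrec symbols :: "'s fm \<Rightarrow> 's signature" where
  "symbols Falsum = {}"
| "symbols (Eql x y) = {}"
| "symbols (Rel R xs) = {(R, length xs)}"
| "symbols (Imp \<phi> \<psi>) = symbols \<phi> \<union> symbols \<psi>"
| "symbols (Forall \<phi>) = symbols \<phi>"

definition sentences :: "'s signature \<Rightarrow> 's fm set" where
  "sentences \<Sigma> = {\<phi>. free_vars \<phi> = {} \<and> symbols \<phi> \<subseteq> \<Sigma>}"

primrec rename :: "(nat \<Rightarrow> nat) \<Rightarrow> 's fm \<Rightarrow> 's fm" where
  "rename f Falsum = Falsum"
| "rename f (Eql x y) = Eql (f x) (f y)"
| "rename f (Rel R xs) = Rel R (map f xs)"
| "rename f (Imp \<phi> \<psi>) = Imp (rename f \<phi>) (rename f \<psi>)"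
| "rename f (Forall \<phi>) = Forall (rename (case_nat 0 (\<lambda>x. Suc (f x))) \<phi>)"

text \<open>
  \<open>inst y \<phi>\<close> replaces the outermost variable 0 of \<open>\<phi>\<close> by \<open>y\<close> and lowers the others,
  so it is the instance of \<open>Forall \<phi>\<close> at \<open>y\<close>.
\<close>

definition inst :: "nat \<Rightarrow> 's fm \<Rightarrow> 's fm" where
  "inst y = rename (case_nat y (\<lambda>x. x))"

text \<open>
  Natural deduction for classical first-order logic with equality. In \<open>ForallI\<close> the hypotheses
  are shifted away from variable 0, which is the eigenvariable condition.
\<close>

inductive deduces :: "'s fm set \<Rightarrow> 's fm \<Rightarrow> bool" (infix "\<turnstile>" 50) where
  Hyp: "\<phi> \<in> \<Gamma> \<Longrightarrow> \<Gamma> \<turnstile> \<phi>"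
| ImpI: "insert \<phi> \<Gamma> \<turnstile> \<psi> \<Longrightarrow> \<Gamma> \<turnstile> Imp \<phi> \<psi>"
| ImpE: "\<Gamma> \<turnstile> Imp \<phi> \<psi> \<Longrightarrow> \<Gamma> \<turnstile> \<phi> \<Longrightarrow> \<Gamma> \<turnstile> \<psi>"
| Classical: "insert (Neg \<phi>) \<Gamma> \<turnstile> Falsum \<Longrightarrow> \<Gamma> \<turnstile> \<phi>"
| ForallI: "rename Suc ` \<Gamma> \<turnstile> \<phi> \<Longrightarrow> \<Gamma> \<turnstile> Forall \<phi>"
| ForallE: "\<Gamma> \<turnstile> Forall \<phi> \<Longrightarrow> \<Gamma> \<turnstile> inst y \<phi>"
| EqlRefl: "\<Gamma> \<turnstile> Eql x x"
| EqlSubst: "\<Gamma> \<turnstile> Eql x y \<Longrightarrow> \<Gamma> \<turnstile> inst x \<phi> \<Longrightarrow> \<Gamma> \<turnstile> inst y \<phi>"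


section \<open>Complete theories\<close>

datatype 's fo_theory = Theory (lang: "'s signature") (thms: "'s fm set")

definition complete_theory :: "'s fo_theory \<Rightarrow> bool" where
  "complete_theory T \<longleftrightarrow>
     thms T = {\<phi> \<in> sentences (lang T). thms T \<turnstile> \<phi>} \<and>
     \<not> thms T \<turnstile> Falsum \<and>
     (\<forall>\<phi>\<in>sentences (lang T). \<phi> \<in> thms T \<or> Neg \<phi> \<in> thms T)"

text \<open>
  \<open>expand \<Sigma> T\<close>, for \<open>\<Sigma>\<close> containing the language of \<open>T\<close>, is the theory of the models of \<open>T\<close> with
  every symbol missing from \<open>T\<close> interpreted as the empty predicate.
\<close>

definition empty_predicate :: "'s \<times> nat \<Rightarrow> 's fm" where
  "empty_predicate = (\<lambda>(R, n). (Forall ^^ n) (Neg (Rel R [0..<n])))"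

definition expand :: "'s signature \<Rightarrow> 's fo_theory \<Rightarrow> 's fo_theory" where
  "expand \<Sigma> T =
     Theory \<Sigma> {\<phi> \<in> sentences \<Sigma>. thms T \<union> empty_predicate ` (\<Sigma> - lang T) \<turnstile> \<phi>}"

definition family_lang :: "'s fo_theory set \<Rightarrow> 's signature" where
  "family_lang \<T> = (\<Union>T\<in>\<T>. lang T)"

text \<open>
  Theories in different languages are compared after expansion to a common language, so members
  of a family are counted up to this identification.
\<close>

definition identified_family :: "'s fo_theory set \<Rightarrow> 's fo_theory set" where
  "identified_family \<T> = expand (family_lang \<T>) ` \<T>"


section \<open>Approximation\<close>

definition approximated :: "'s fo_theory set \<Rightarrow> 's fo_theory \<Rightarrow> bool" where
  "approximated \<T> T \<longleftrightarrow>
     (let \<Sigma> = family_lang (insert T \<T>) in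
        expand \<Sigma> T \<notin> expand \<Sigma> ` \<T> \<and>
        (\<forall>\<phi>\<in>thms (expand \<Sigma> T). \<exists>T'\<in>\<T>. \<phi> \<in> thms (expand \<Sigma> T')))"

definition approximating_family :: "'s fo_theory set \<Rightarrow> bool" where
  "approximating_family \<T> \<longleftrightarrow> (\<exists>T. complete_theory T \<and> approximated \<T> T)"

end

(*
  For fixed language the complete theories form a Stone space, with a sentence as a clopen set and
  the approximated theories as accumulation points. A finite family has none: the conjunction of
  sentences separating T from each member lies in T but in no member. An infinite family has one by
  compactness; it is approximated by the members that differ from it.
  Expansion is handled by erasure: replacing every missing predicate by Falsum preserves
  derivations and trivialises the axioms of empty predicates, so phi lies in the expansion of T
  exactly if its erasure lies in T.
*)
theory Submission
  imports Defs
begin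

section \<open>Derivations\<close>

abbreviation lift :: "(nat \<Rightarrow> nat) \<Rightarrow> nat \<Rightarrow> nat" where
  "lift f \<equiv> case_nat 0 (\<lambda>x. Suc (f x))"

lemma lift_comp: "lift f \<circ> lift g = lift (\<lambda>x. f (g x))"
  by (auto simp: fun_eq_iff split: nat.splits)

lemma rename_rename: "rename f (rename g \<phi>) = rename (f \<circ> g) \<phi>"
  by (induction \<phi> arbitrary: f g) (simp_all add: lift_comp)

lemma rename_fixed: "(\<And>x. x \<in> free_vars \<phi> \<Longrightarrow> f x = x) \<Longrightarrow> rename f \<phi> = \<phi>"
proof (induction \<phi> arbitrary: f)
  case (Forall \<phi>)
  have "rename (lift f) \<phi> = \<phi>"
    by (rule Forall.IH) (use Forall.prems in \<open>auto split: nat.split\<close>)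
  then show ?case by simp
qed (auto simp: map_idI)

lemma rename_closed: "free_vars \<phi> = {} \<Longrightarrow> rename f \<phi> = \<phi>"
  by (rule rename_fixed) simp

lemma rename_Suc_closed:
  assumes "\<And>\<phi>. \<phi> \<in> \<Gamma> \<Longrightarrow> free_vars \<phi> = {}"
  shows "rename Suc ` \<Gamma> = \<Gamma>"
  using assms by (simp add: rename_closed)

text \<open>An instance is itself a renaming, so only two maps on indices have to be
  compared.\<close>

lemma rename_inst: "rename f (inst y \<phi>) = inst (f y) (rename (lift f) \<phi>)"
proof -
  have "f \<circ> case_nat y (\<lambda>x. x) = case_nat (f y) (\<lambda>x. x) \<circ> lift f"
    by (auto simp: fun_eq_iff split: nat.splits)
  then show ?thesis
    by (simp add: inst_def rename_rename)
qed

lemma rename_rename_Suc: "rename (lift f) (rename Suc \<phi>) = rename Suc (rename f \<phi>)"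
proof -
  have "lift f \<circ> Suc = Suc \<circ> f"
    by (auto simp: fun_eq_iff)
  then show ?thesis
    by (simp add: rename_rename)
qed

text \<open>Undoes the shift that \<open>ForallI\<close> applies to a quantified hypothesis: its
  instance at the eigenvariable 0 is the original body.\<close>

lemma inst_0_lift_Suc: "inst 0 (rename (lift Suc) \<phi>) = \<phi>"
proof -
  have "case_nat 0 (\<lambda>x. x) \<circ> lift Suc = id"
    by (auto simp: fun_eq_iff split: nat.splits)
  then show ?thesis
    by (simp add: inst_def rename_rename rename_fixed)
qed

section \<open>Structural properties of derivability\<close>

lemma weaken: "\<Gamma> \<turnstile> \<phi> \<Longrightarrow> \<Gamma> \<subseteq> \<Delta> \<Longrightarrow> \<Delta> \<turnstile> \<phi>"
proof (induction arbitrary: \<Delta> rule: deduces.induct)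
  case (ImpI \<phi> \<Gamma> \<psi>)
  then show ?case by (meson deduces.ImpI insert_mono)
next
  case (Classical \<phi> \<Gamma>)
  then show ?case by (meson deduces.Classical insert_mono)
next
  case (ForallI \<Gamma> \<phi>)
  then show ?case by (meson deduces.ForallI image_mono)
qed (blast intro: deduces.intros)+

text \<open>Under \<open>ForallI\<close> the induction hypothesis is used for \<open>lift f\<close>,
  which fixes the eigenvariable 0 and commutes with the shift of the hypotheses.\<close>

lemma deduces_rename: "\<Gamma> \<turnstile> \<phi> \<Longrightarrow> rename f ` \<Gamma> \<turnstile> rename f \<phi>"
proof (induction arbitrary: f rule: deduces.induct)
  case (ForallI \<Gamma> \<phi>)
  have "rename (lift f) ` rename Suc ` \<Gamma> = rename Suc ` rename f ` \<Gamma>"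
    by (simp add: image_image rename_rename_Suc)
  then show ?case
    using ForallI.IH[of "lift f"] by (auto intro: deduces.ForallI)
next
  case (ForallE \<Gamma> \<phi> y)
  then show ?case by (auto simp: rename_inst intro: deduces.ForallE)
next
  case (EqlSubst \<Gamma> x y \<phi>)
  show ?case
    using EqlSubst.IH[of f] unfolding rename_inst
    by (auto intro: deduces.EqlSubst)
qed (auto intro: deduces.intros)

text \<open>Induction with the new context left arbitrary; under \<open>ForallI\<close> the
  derivations of the replaced hypotheses are shifted by \<open>deduces_rename\<close>.\<close>

lemma cut: "\<Delta> \<turnstile> \<phi> \<Longrightarrow> (\<And>\<delta>. \<delta> \<in> \<Delta> \<Longrightarrow> \<Gamma> \<turnstile> \<delta>) \<Longrightarrow> \<Gamma> \<turnstile> \<phi>"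
proof (induction arbitrary: \<Gamma> rule: deduces.induct)
  case (ImpI \<phi> \<Delta> \<psi>)
  show ?case
    by (rule deduces.ImpI, rule ImpI.IH) (auto intro: Hyp weaken[OF ImpI.prems])
next
  case (Classical \<phi> \<Delta>)
  show ?case
    by (rule deduces.Classical, rule Classical.IH) (auto intro: Hyp weaken[OF Classical.prems])
next
  case (ForallI \<Delta> \<phi>)
  show ?case
    by (rule deduces.ForallI, rule ForallI.IH) (auto intro: deduces_rename ForallI.prems)
qed (blast intro: deduces.intros)+

text \<open>Syntactic compactness: a rule with two premises unites their finite sets, and a
  discharging rule removes the discharged formula.\<close>

lemma deduces_finite: "\<Gamma> \<turnstile> \<phi> \<Longrightarrow> \<exists>\<Delta>\<subseteq>\<Gamma>. finite \<Delta> \<and> \<Delta> \<turnstile> \<phi>"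
proof (induction rule: deduces.induct)
  case (Hyp \<phi> \<Gamma>)
  then show ?case by (intro exI[of _ "{\<phi>}"]) (auto intro: deduces.Hyp)
next
  case (ImpI \<phi> \<Gamma> \<psi>)
  then obtain \<Delta> where "\<Delta> \<subseteq> insert \<phi> \<Gamma>" "finite \<Delta>" and \<Delta>: "\<Delta> \<turnstile> \<psi>" by blast
  then show ?case
    by (intro exI[of _ "\<Delta> - {\<phi>}"]) (auto intro!: deduces.ImpI weaken[OF \<Delta>])
next
  case (ImpE \<Gamma> \<phi> \<psi>)
  then obtain \<Delta> \<Delta>' where "\<Delta> \<subseteq> \<Gamma>" "finite \<Delta>" "\<Delta>' \<subseteq> \<Gamma>" "finite \<Delta>'"
    and \<Delta>: "\<Delta> \<turnstile> Imp \<phi> \<psi>" "\<Delta>' \<turnstile> \<phi>"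
    by blast
  moreover have "\<Delta> \<union> \<Delta>' \<turnstile> \<psi>"
    by (rule deduces.ImpE[OF weaken[OF \<Delta>(1)] weaken[OF \<Delta>(2)]]) auto
  ultimately show ?case
    by (intro exI[of _ "\<Delta> \<union> \<Delta>'"]) simp
next
  case (Classical \<phi> \<Gamma>)
  then obtain \<Delta> where "\<Delta> \<subseteq> insert (Neg \<phi>) \<Gamma>" "finite \<Delta>" and \<Delta>: "\<Delta> \<turnstile> Falsum" by blast
  then show ?case
    by (intro exI[of _ "\<Delta> - {Neg \<phi>}"]) (auto intro!: deduces.Classical weaken[OF \<Delta>])
next
  case (ForallI \<Gamma> \<phi>)
  then obtain \<Delta> where "\<Delta> \<subseteq> rename Suc ` \<Gamma>" "finite \<Delta>" "\<Delta> \<turnstile> \<phi>" by blast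
  \<comment> \<open>A finite set of shifted hypotheses is the shift of a finite set of
    hypotheses.\<close>
  then show ?case
    by (metis deduces.ForallI finite_subset_image)
next
  case (ForallE \<Gamma> \<phi> y)
  then show ?case by (blast intro: deduces.ForallE)
next
  case (EqlRefl \<Gamma> x)
  then show ?case by (blast intro: deduces.EqlRefl)
next
  case (EqlSubst \<Gamma> x y \<phi>)
  then obtain \<Delta> \<Delta>' where "\<Delta> \<subseteq> \<Gamma>" "finite \<Delta>" "\<Delta>' \<subseteq> \<Gamma>" "finite \<Delta>'"
    and \<Delta>: "\<Delta> \<turnstile> Eql x y" "\<Delta>' \<turnstile> inst x \<phi>"
    by blast
  moreover have "\<Delta> \<union> \<Delta>' \<turnstile> inst y \<phi>"
    by (rule deduces.EqlSubst[OF weaken[OF \<Delta>(1)] weaken[OF \<Delta>(2)]]) auto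
  ultimately show ?case
    by (intro exI[of _ "\<Delta> \<union> \<Delta>'"]) simp
qed

lemma deduces_Falsum_elim: "\<Gamma> \<turnstile> Falsum \<Longrightarrow> \<Gamma> \<turnstile> \<phi>"
  by (rule Classical) (erule weaken, blast)

text \<open>\<open>Neg (Imp \<phi> (Neg \<psi>))\<close> is the classical encoding of conjunction;
  these are its elimination rules.\<close>

lemma deduces_Neg_Imp:
  assumes "\<Gamma> \<turnstile> Neg (Imp \<phi> (Neg \<psi>))"
  shows "\<Gamma> \<turnstile> \<phi>" and "\<Gamma> \<turnstile> \<psi>"
proof -
  have "insert (Neg \<phi>) \<Gamma> \<turnstile> Imp \<phi> (Neg \<psi>)"
    by (rule ImpI, rule deduces_Falsum_elim, rule ImpE[of _ \<phi>]) (auto intro: Hyp)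
  then show "\<Gamma> \<turnstile> \<phi>"
    by (meson Classical ImpE weaken[OF assms] subset_insertI)
  have "insert (Neg \<psi>) \<Gamma> \<turnstile> Imp \<phi> (Neg \<psi>)"
    by (auto intro: ImpI Hyp)
  then show "\<Gamma> \<turnstile> \<psi>"
    by (meson Classical ImpE weaken[OF assms] subset_insertI)
qed

lemma deduces_Neg_ImpI:
  assumes "\<Gamma> \<turnstile> \<phi>" and "\<Gamma> \<turnstile> \<psi>"
  shows "\<Gamma> \<turnstile> Neg (Imp \<phi> (Neg \<psi>))"
proof (rule ImpI, rule ImpE[of _ \<psi>], rule ImpE[of _ \<phi>])
  show "insert (Imp \<phi> (Neg \<psi>)) \<Gamma> \<turnstile> Imp \<phi> (Neg \<psi>)" by (simp add: Hyp)
qed (auto intro: weaken[OF assms(1)] weaken[OF assms(2)])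


section \<open>Erasing predicates from formulas\<close>

text \<open>\<open>L\<close> is the set of symbols that are kept. Name and arity are tested
  together, since the same name with another arity is a different symbol.\<close>

primrec erase :: "'s signature \<Rightarrow> 's fm \<Rightarrow> 's fm" where
  "erase L Falsum = Falsum"
| "erase L (Eql x y) = Eql x y"
| "erase L (Rel R xs) = (if (R, length xs) \<in> L then Rel R xs else Falsum)"
| "erase L (Imp \<phi> \<psi>) = Imp (erase L \<phi>) (erase L \<psi>)"
| "erase L (Forall \<phi>) = Forall (erase L \<phi>)"

lemma symbols_erase: "symbols (erase L \<phi>) \<subseteq> L"
  by (induction \<phi>) auto

lemma free_vars_erase: "free_vars (erase L \<phi>) \<subseteq> free_vars \<phi>"
  by (induction \<phi>) auto

lemma erase_in_sentences: "\<phi> \<in> sentences \<Sigma> \<Longrightarrow> erase L \<phi> \<in> sentences L"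
  using free_vars_erase symbols_erase by (fastforce simp: sentences_def)

lemma erase_id: "symbols \<phi> \<subseteq> L \<Longrightarrow> erase L \<phi> = \<phi>"
  by (induction \<phi>) auto

lemma erase_erase: "L \<subseteq> L' \<Longrightarrow> erase L (erase L' \<phi>) = erase L \<phi>"
  by (induction \<phi>) auto

lemma erase_rename: "erase L (rename f \<phi>) = rename f (erase L \<phi>)"
  by (induction \<phi> arbitrary: f) auto

lemma erase_inst: "erase L (inst y \<phi>) = inst y (erase L \<phi>)"
  by (simp add: inst_def erase_rename)

text \<open>Whether an atom is erased depends only on its name and number of arguments, so erasure
  commutes with renaming and instantiation and every rule survives.\<close>

lemma deduces_erase: "\<Gamma> \<turnstile> \<phi> \<Longrightarrow> erase L ` \<Gamma> \<turnstile> erase L \<phi>"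
proof (induction rule: deduces.induct)
  case (ForallI \<Gamma> \<phi>)
  have "erase L ` rename Suc ` \<Gamma> = rename Suc ` erase L ` \<Gamma>"
    by (simp add: image_image erase_rename)
  then show ?case
    using ForallI.IH by (auto intro: deduces.ForallI)
next
  case (ForallE \<Gamma> \<phi> y)
  then show ?case by (auto simp: erase_inst intro: deduces.ForallE)
next
  case (EqlSubst \<Gamma> x y \<phi>)
  then show ?case
    unfolding erase_inst by (auto intro: deduces.EqlSubst)
qed (auto intro: deduces.intros)

section \<open>Blocks of quantifiers and the axioms of empty predicates\<close>

lemma free_vars_Forall_funpow: "free_vars ((Forall ^^ n) \<phi>) = {x. x + n \<in> free_vars \<phi>}"
  by (induction n) auto

lemma erase_Forall_funpow: "erase L ((Forall ^^ n) \<phi>) = (Forall ^^ n) (erase L \<phi>)"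
  by (induction n) auto

lemma free_vars_empty_predicate: "free_vars (empty_predicate P) = {}"
  by (cases P) (auto simp: empty_predicate_def free_vars_Forall_funpow)

text \<open>Derivability from every context is assumed because each \<open>ForallI\<close> shifts
  the hypotheses.\<close>

lemma deduces_Forall_funpowI:
  assumes "\<And>\<Gamma>. \<Gamma> \<turnstile> \<phi>"
  shows "\<Gamma> \<turnstile> (Forall ^^ n) \<phi>"
  by (induction n arbitrary: \<Gamma>) (auto intro: assms ForallI)

lemma deduces_erase_empty_predicate:
  assumes "P \<notin> L"
  shows "\<Gamma> \<turnstile> erase L (empty_predicate P)"
proof -
  have "\<Gamma> \<turnstile> Neg Falsum" for \<Gamma> :: "'a fm set"
    by (rule ImpI, rule Hyp) simp
  then show ?thesis
    using assms
    by (cases P) (simp add: empty_predicate_def erase_Forall_funpow deduces_Forall_funpowI)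
qed

text \<open>Simultaneous instantiation: \<open>ys ! i\<close> replaces variable \<open>i\<close>,
  and the variables beyond the block drop by its length.\<close>

lemma deduces_Forall_funpowE:
  "\<Gamma> \<turnstile> (Forall ^^ length ys) \<phi> \<Longrightarrow>
    \<Gamma> \<turnstile> rename (\<lambda>i. if i < length ys then ys ! i else i - length ys) \<phi>"
proof (induction ys arbitrary: \<phi>)
  case Nil
  then show ?case by (simp add: rename_fixed)
next
  case (Cons y ys)
  let ?f = "\<lambda>ys i. if i < length ys then ys ! i else i - length ys"
  \<comment> \<open>The head \<open>y\<close> belongs to variable 0, hence to the innermost
    quantifier. That quantifier is set aside while the induction hypothesis instantiates the
    others.\<close>
  have "\<Gamma> \<turnstile> (Forall ^^ length ys) (Forall \<phi>)"
    using Cons.prems by (simp add: funpow_swap1)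
  then have "\<Gamma> \<turnstile> Forall (rename (lift (?f ys)) \<phi>)"
    using Cons.IH by fastforce
  then have "\<Gamma> \<turnstile> inst y (rename (lift (?f ys)) \<phi>)"
    by (rule ForallE)
  moreover have "case_nat y (\<lambda>x. x) \<circ> lift (?f ys) = ?f (y # ys)"
    by (auto simp: fun_eq_iff split: nat.splits)
  ultimately show ?case
    by (simp add: inst_def rename_rename)
qed

lemma deduces_Neg_Rel:
  assumes "empty_predicate (R, length xs) \<in> \<Gamma>"
  shows "\<Gamma> \<turnstile> Neg (Rel R xs)"
proof -
  have "\<Gamma> \<turnstile> (Forall ^^ length xs) (Neg (Rel R [0..<length xs]))"
    using assms by (auto simp: empty_predicate_def intro: Hyp)
  from deduces_Forall_funpowE[OF this]
  have "\<Gamma> \<turnstile> Neg (Rel R (map (\<lambda>i. if i < length xs then xs ! i else i - length xs) [0..<length xs]))"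
    by simp
  moreover have "map (\<lambda>i. if i < length xs then xs ! i else i - length xs) [0..<length xs] = xs"
    by (rule nth_equalityI) auto
  ultimately show ?thesis by simp
qed

section \<open>Provable equivalence of a formula with its erasure\<close>

lemma deduces_Forall_mono:
  assumes "rename Suc ` \<Gamma> = \<Gamma>" and "\<Gamma> \<turnstile> Imp \<phi> \<psi>"
  shows "\<Gamma> \<turnstile> Imp (Forall \<phi>) (Forall \<psi>)"
proof (rule ImpI, rule ForallI)
  let ?\<Delta> = "rename Suc ` insert (Forall \<phi>) \<Gamma>"
  have "?\<Delta> \<turnstile> Forall (rename (lift Suc) \<phi>)"
    by (rule Hyp) simp
  then have "?\<Delta> \<turnstile> \<phi>"
    using ForallE[of _ "rename (lift Suc) \<phi>" 0] by (simp add: inst_0_lift_Suc)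
  moreover have "?\<Delta> \<turnstile> Imp \<phi> \<psi>"
    by (rule weaken[OF assms(2)]) (use assms(1) in auto)
  ultimately show "?\<Delta> \<turnstile> \<psi>"
    by (rule ImpE[rotated])
qed

lemma deduces_Imp_mono:
  assumes "\<Gamma> \<turnstile> Imp \<phi>' \<phi>" and "\<Gamma> \<turnstile> Imp \<psi> \<psi>'"
  shows "\<Gamma> \<turnstile> Imp (Imp \<phi> \<psi>) (Imp \<phi>' \<psi>')"
proof (intro ImpI)
  let ?\<Delta> = "insert \<phi>' (insert (Imp \<phi> \<psi>) \<Gamma>)"
  have "?\<Delta> \<turnstile> Imp \<phi>' \<phi>" "?\<Delta> \<turnstile> Imp \<psi> \<psi>'" "?\<Delta> \<turnstile> \<phi>'" "?\<Delta> \<turnstile> Imp \<phi> \<psi>"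
    by (auto intro: weaken[OF assms(1)] weaken[OF assms(2)] Hyp)
  then show "?\<Delta> \<turnstile> \<psi>'"
    by (meson ImpE)
qed

lemma deduces_erase_iff:
  assumes \<Gamma>: "rename Suc ` \<Gamma> = \<Gamma>" "empty_predicate ` (\<Sigma> - L) \<subseteq> \<Gamma>"
    and "symbols \<phi> \<subseteq> \<Sigma>"
  shows "\<Gamma> \<turnstile> \<phi> \<longleftrightarrow> \<Gamma> \<turnstile> erase L \<phi>"
proof -
  \<comment> \<open>Both implications go through one induction, because \<open>Imp\<close> reverses
    direction in its antecedent. An erased atom is refuted by its axiom.\<close>
  have "\<Gamma> \<turnstile> Imp \<phi> (erase L \<phi>) \<and> \<Gamma> \<turnstile> Imp (erase L \<phi>) \<phi>"
    using assms(3)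
  proof (induction \<phi>)
    case (Rel R xs)
    show ?case
    proof (cases "(R, length xs) \<in> L")
      case True
      then show ?thesis by (auto intro: ImpI Hyp)
    next
      case False
      with Rel \<Gamma>(2) have "\<Gamma> \<turnstile> Neg (Rel R xs)"
        by (intro deduces_Neg_Rel) auto
      with False show ?thesis
        by (auto intro: ImpI[OF deduces_Falsum_elim[OF Hyp]])
    qed
  qed (auto intro: ImpI Hyp deduces_Imp_mono deduces_Forall_mono[OF \<Gamma>(1)])
  then show ?thesis
    by (meson ImpE)
qed


section \<open>Complete theories and their expansions\<close>

lemma in_thms_iff:
  "complete_theory T \<Longrightarrow> \<phi> \<in> thms T \<longleftrightarrow> \<phi> \<in> sentences (lang T) \<and> thms T \<turnstile> \<phi>"
  unfolding complete_theory_def by blast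

text \<open>Complete theories are maximal: a sentence of \<open>T\<close> missing from
  \<open>S\<close> has its negation in \<open>S\<close>, hence in the consistent
  \<open>T\<close>.\<close>

lemma thms_subset_eq:
  assumes "complete_theory S" "complete_theory T" "lang S = lang T" "thms S \<subseteq> thms T"
  shows "S = T"
proof (rule fo_theory.expand)
  have "\<phi> \<in> thms S" if "\<phi> \<in> thms T" for \<phi>
  proof (rule ccontr)
    assume "\<phi> \<notin> thms S"
    then have "Neg \<phi> \<in> thms T"
      using assms that by (auto simp: complete_theory_def)
    then have "thms T \<turnstile> Falsum"
      using that by (meson Hyp ImpE)
    then show False
      using assms(2) by (simp add: complete_theory_def)
  qed
  then show "lang S = lang T \<and> thms S = thms T"
    using assms by auto
qed

lemma lang_expand [simp]: "lang (expand \<Sigma> T) = \<Sigma>"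
  by (simp add: expand_def)

lemma expand_lang:
  assumes "complete_theory T"
  shows "expand (lang T) T = T"
  by (rule fo_theory.expand) (use assms in \<open>simp add: expand_def complete_theory_def\<close>)

lemma in_thms_expand_iff:
  assumes T: "complete_theory T" and "lang T \<subseteq> \<Sigma>"
  shows "\<phi> \<in> thms (expand \<Sigma> T) \<longleftrightarrow> \<phi> \<in> sentences \<Sigma> \<and> erase (lang T) \<phi> \<in> thms T"
proof (cases "\<phi> \<in> sentences \<Sigma>")
  case True
  let ?\<Gamma> = "thms T \<union> empty_predicate ` (\<Sigma> - lang T)"
  have closed: "rename Suc ` ?\<Gamma> = ?\<Gamma>"
    by (rule rename_Suc_closed)
      (use T in \<open>auto simp: in_thms_iff sentences_def free_vars_empty_predicate\<close>)
  \<comment> \<open>Conservativity: erasing a whole derivation fixes the members of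
    \<open>thms T\<close> and turns the added axioms into theorems of pure logic.\<close>
  have "thms T \<turnstile> erase (lang T) \<phi>" if "?\<Gamma> \<turnstile> erase (lang T) \<phi>"
  proof (rule cut)
    show "erase (lang T) ` ?\<Gamma> \<turnstile> erase (lang T) \<phi>"
      using deduces_erase[OF that, of "lang T"] by (simp add: erase_erase)
    fix \<delta>
    assume "\<delta> \<in> erase (lang T) ` ?\<Gamma>"
    then show "thms T \<turnstile> \<delta>"
      using T by (auto simp: in_thms_iff sentences_def erase_id deduces_erase_empty_predicate)
  qed
  then have "thms T \<turnstile> erase (lang T) \<phi> \<longleftrightarrow> ?\<Gamma> \<turnstile> erase (lang T) \<phi>"
    using weaken by blast
  also have "\<dots> \<longleftrightarrow> ?\<Gamma> \<turnstile> \<phi>"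
    using deduces_erase_iff[OF closed] True by (auto simp: sentences_def)
  finally show ?thesis
    using True T erase_in_sentences[OF True] by (auto simp: expand_def in_thms_iff)
qed (simp add: expand_def)

text \<open>Erasure maps the expansion into \<open>thms T\<close> and commutes with
  \<open>Imp\<close> and \<open>Falsum\<close>, so closure, consistency and completeness are
  inherited from \<open>T\<close>.\<close>

lemma complete_theory_expand:
  assumes T: "complete_theory T" and "lang T \<subseteq> \<Sigma>"
  shows "complete_theory (expand \<Sigma> T)"
proof -
  note iff = in_thms_expand_iff[OF assms]
  have erase: "thms T \<turnstile> erase (lang T) \<phi>" if "thms (expand \<Sigma> T) \<turnstile> \<phi>" for \<phi>
    by (rule cut[OF deduces_erase[OF that, of "lang T"]]) (auto simp: iff intro: Hyp)
  have "\<phi> \<in> thms (expand \<Sigma> T)" if "\<phi> \<in> sentences \<Sigma>" "thms (expand \<Sigma> T) \<turnstile> \<phi>" for \<phi>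
    using that erase[of \<phi>] T by (auto simp: iff in_thms_iff erase_in_sentences)
  moreover have "\<not> thms (expand \<Sigma> T) \<turnstile> Falsum"
    using erase[of Falsum] T by (auto simp: complete_theory_def)
  moreover have "\<phi> \<in> thms (expand \<Sigma> T) \<or> Neg \<phi> \<in> thms (expand \<Sigma> T)" if "\<phi> \<in> sentences \<Sigma>" for \<phi>
    using that T erase_in_sentences[OF that, of "lang T"]
    by (auto simp: iff complete_theory_def sentences_def)
  ultimately show ?thesis
    by (auto simp: complete_theory_def iff intro: Hyp)
qed

text \<open>
  Passing through the erasure of \<open>\<phi>\<close> to \<open>lang S \<union> lang T\<close> shows that the identification of two
  theories does not depend on the common language. The languages in which the family and an
  approximating subfamily are compared may be incomparable.
\<close>

lemma expand_eq_transfer: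
  assumes "complete_theory S" "complete_theory T"
    and "lang S \<subseteq> \<Sigma>" "lang T \<subseteq> \<Sigma>" "lang S \<subseteq> \<Sigma>'" "lang T \<subseteq> \<Sigma>'"
    and "expand \<Sigma> S = expand \<Sigma> T"
  shows "expand \<Sigma>' S = expand \<Sigma>' T"
proof (rule fo_theory.expand)
  have "\<phi> \<in> thms (expand \<Sigma>' S) \<longleftrightarrow> \<phi> \<in> thms (expand \<Sigma>' T)" for \<phi>
  proof (cases "\<phi> \<in> sentences \<Sigma>'")
    case True
    define \<psi> where "\<psi> = erase (lang S \<union> lang T) \<phi>"
    have \<psi>: "\<psi> \<in> sentences \<Sigma>"
      using erase_in_sentences[OF True, of "lang S \<union> lang T"] assms
      by (auto simp: \<psi>_def sentences_def)
    have "erase (lang S) \<psi> = erase (lang S) \<phi>" "erase (lang T) \<psi> = erase (lang T) \<phi>"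
      by (simp_all add: \<psi>_def erase_erase)
    then have "\<phi> \<in> thms (expand \<Sigma>' S) \<longleftrightarrow> \<psi> \<in> thms (expand \<Sigma> S)"
      "\<phi> \<in> thms (expand \<Sigma>' T) \<longleftrightarrow> \<psi> \<in> thms (expand \<Sigma> T)"
      using True \<psi> by (simp_all add: assms(1-6) in_thms_expand_iff)
    then show ?thesis
      using assms by simp
  qed (use assms in \<open>simp add: in_thms_expand_iff\<close>)
  then show "lang (expand \<Sigma>' S) = lang (expand \<Sigma>' T) \<and>
      thms (expand \<Sigma>' S) = thms (expand \<Sigma>' T)"
    by auto
qed


section \<open>Finite and infinite families\<close>

text \<open>By maximality each member omits some sentence of \<open>S\<close>; the induction
  collects these sentences into one conjunction.\<close>

lemma finite_family_separated:
  assumes "finite \<S>" and S: "complete_theory S" and "S \<notin> \<S>"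
    and "\<And>S'. S' \<in> \<S> \<Longrightarrow> complete_theory S' \<and> lang S' = lang S"
  shows "\<exists>\<phi>\<in>thms S. \<forall>S'\<in>\<S>. \<phi> \<notin> thms S'"
  using assms(1,3,4)
proof (induction rule: finite_induct)
  case empty
  have "Neg Falsum \<in> thms S"
    using S by (auto simp: in_thms_iff sentences_def intro: ImpI Hyp)
  then show ?case by blast
next
  case (insert S1 \<S>)
  then obtain \<phi> where \<phi>: "\<phi> \<in> thms S" "\<And>S'. S' \<in> \<S> \<Longrightarrow> \<phi> \<notin> thms S'"
    by auto
  obtain \<psi> where \<psi>: "\<psi> \<in> thms S" "\<psi> \<notin> thms S1"
    using thms_subset_eq[of S S1] S insert.prems by auto
  have sent: "\<phi> \<in> sentences (lang S)" "\<psi> \<in> sentences (lang S)"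
    using \<phi> \<psi> S by (auto simp: in_thms_iff)
  have "thms S \<turnstile> Neg (Imp \<phi> (Neg \<psi>))"
    using \<phi> \<psi> by (auto intro: deduces_Neg_ImpI Hyp)
  then have "Neg (Imp \<phi> (Neg \<psi>)) \<in> thms S"
    using sent S by (auto simp: in_thms_iff sentences_def)
  moreover have "\<phi> \<in> thms S' \<and> \<psi> \<in> thms S'"
    if "S' \<in> insert S1 \<S>" "Neg (Imp \<phi> (Neg \<psi>)) \<in> thms S'" for S'
    using deduces_Neg_Imp[OF Hyp[OF that(2)]] insert.prems(2)[OF that(1)] sent
    by (simp add: in_thms_iff)
  ultimately show ?case
    using \<phi> \<psi> by blast
qed

text \<open>
  An accumulation point in the Stone space of complete theories: the sets whose finite parts are
  each contained in infinitely many members of the family have a maximal element.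
\<close>

lemma infinite_family_accumulates:
  assumes "infinite \<S>" and \<S>: "\<And>S. S \<in> \<S> \<Longrightarrow> complete_theory S \<and> lang S = \<Sigma>"
  shows "\<exists>M. complete_theory (Theory \<Sigma> M) \<and> (\<forall>\<phi>\<in>M. infinite {S \<in> \<S>. \<phi> \<in> thms S})"
proof -
  define above where "above B = {S \<in> \<S>. B \<subseteq> thms S}" for B
  \<comment> \<open>Infinitely many members above each finite part, not just one, make the maximal
    set an accumulation point.\<close>
  define good where
    "good A \<longleftrightarrow> A \<subseteq> sentences \<Sigma> \<and> (\<forall>B\<subseteq>A. finite B \<longrightarrow> infinite (above B))" for A
  have "\<exists>M\<in>Collect good. \<forall>A\<in>Collect good. M \<subseteq> A \<longrightarrow> A = M"
  proof (rule subset_Zorn_nonempty)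
    have "good {}"
      using \<open>infinite \<S>\<close> by (auto simp: good_def above_def)
    then show "Collect good \<noteq> {}" by blast
  next
    fix C
    assume C: "C \<noteq> {}" "subset.chain (Collect good) C"
    have "infinite (above B)" if B: "B \<subseteq> \<Union>C" "finite B" for B
    proof -
      obtain A where "A \<in> C" "B \<subseteq> A"
        using finite_subset_Union_chain[OF B(2,1) C] by blast
      then show ?thesis
        using C(2) B(2) by (auto simp: subset_chain_def good_def)
    qed
    moreover have "\<Union>C \<subseteq> sentences \<Sigma>"
      using C(2) by (fastforce simp: subset_chain_def good_def)
    ultimately show "\<Union>C \<in> Collect good"
      by (simp add: good_def)
  qed
  then obtain M where "good M" and max: "\<And>A. good A \<Longrightarrow> M \<subseteq> A \<Longrightarrow> A = M"
    by blast
  then have sent: "M \<subseteq> sentences \<Sigma>"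
    and inf: "\<And>B. B \<subseteq> M \<Longrightarrow> finite B \<Longrightarrow> infinite (above B)"
    by (auto simp: good_def)
  \<comment> \<open>Maximality in finite form: a sentence outside \<open>M\<close> is blocked by a
    finite part of \<open>M\<close>.\<close>
  have ex: "\<exists>B\<subseteq>M. finite B \<and> finite (above (insert \<phi> B))"
    if \<phi>: "\<phi> \<in> sentences \<Sigma>" "\<phi> \<notin> M" for \<phi>
  proof -
    have "\<not> good (insert \<phi> M)"
      using max[of "insert \<phi> M"] \<phi>(2) by blast
    then obtain B where B: "B \<subseteq> insert \<phi> M" "finite B" "finite (above B)"
      using \<phi>(1) sent by (auto simp: good_def)
    have "above (insert \<phi> (B - {\<phi>})) \<subseteq> above B"
      by (auto simp: above_def)
    with B show ?thesis
      by (intro exI[of _ "B - {\<phi>}"]) (auto intro: finite_subset)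
  qed
  have complete: "\<phi> \<in> M \<or> Neg \<phi> \<in> M" if \<phi>: "\<phi> \<in> sentences \<Sigma>" for \<phi>
  proof (rule ccontr)
    assume "\<not> ?thesis"
    moreover have "Neg \<phi> \<in> sentences \<Sigma>"
      using \<phi> by (simp add: sentences_def)
    ultimately obtain B B' where B: "B \<subseteq> M" "finite B" "finite (above (insert \<phi> B))"
      and B': "B' \<subseteq> M" "finite B'" "finite (above (insert (Neg \<phi>) B'))"
      using ex[of \<phi>] ex[of "Neg \<phi>"] \<phi> by blast
    \<comment> \<open>Every member decides \<phi>, so the members above \<open>B \<union> B'\<close>
      split into two finite classes.\<close>
    have "\<phi> \<in> thms S \<or> Neg \<phi> \<in> thms S" if "S \<in> \<S>" for S
      using \<S>[OF that] \<phi> unfolding complete_theory_def by blast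
    then have "above (B \<union> B') \<subseteq> above (insert \<phi> B) \<union> above (insert (Neg \<phi>) B')"
      unfolding above_def by blast
    then show False
      using inf[of "B \<union> B'"] B B' by (auto dest: finite_subset)
  qed
  have consistent: "\<not> M \<turnstile> Falsum"
  proof
    assume "M \<turnstile> Falsum"
    then obtain B where B: "B \<subseteq> M" "finite B" "B \<turnstile> Falsum"
      using deduces_finite by blast
    then obtain S where "S \<in> above B"
      using inf[of B] by (metis ex_in_conv finite.emptyI)
    then show False
      using \<S>[of S] weaken[OF B(3), of "thms S"] by (simp add: above_def complete_theory_def)
  qed
  have "\<phi> \<in> M" if "\<phi> \<in> sentences \<Sigma>" "M \<turnstile> \<phi>" for \<phi>
    using complete[OF that(1)] consistent that(2) by (meson Hyp ImpE)
  then have "complete_theory (Theory \<Sigma> M)"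
    using sent complete consistent by (auto simp: complete_theory_def intro: Hyp)
  moreover have "infinite {S \<in> \<S>. \<phi> \<in> thms S}" if "\<phi> \<in> M" for \<phi>
    using inf[of "{\<phi>}"] that by (simp add: above_def)
  ultimately show ?thesis by blast
qed

text \<open>On \<open>A\<close> the map \<open>g\<close> factors through \<open>f\<close>, with
  \<open>inv_into\<close> choosing representatives.\<close>

lemma finite_image_transfer:
  assumes "finite (f ` A)" and "\<And>x y. x \<in> A \<Longrightarrow> y \<in> A \<Longrightarrow> f x = f y \<Longrightarrow> g x = g y"
  shows "finite (g ` A)"
proof -
  have "g x = g (inv_into A f (f x))" if "x \<in> A" for x
    using that by (intro assms(2)) (auto intro: inv_into_into simp: f_inv_into_f)
  then have "g ` A \<subseteq> (\<lambda>y. g (inv_into A f y)) ` f ` A"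
    by blast
  then show ?thesis
    using assms(1) finite_surj by blast
qed

theorem theorem6p1:
  fixes \<T> :: "'s fo_theory set"
  assumes "\<And>T. T \<in> \<T> \<Longrightarrow> complete_theory T"
  shows "(\<exists>\<T>'. \<T>' \<subseteq> \<T> \<and> approximating_family \<T>') \<longleftrightarrow> infinite (identified_family \<T>)"
proof
  assume "\<exists>\<T>'. \<T>' \<subseteq> \<T> \<and> approximating_family \<T>'"
  then obtain \<T>' T where \<T>': "\<T>' \<subseteq> \<T>" and T: "complete_theory T" "approximated \<T>' T"
    by (auto simp: approximating_family_def)
  define \<Sigma> where "\<Sigma> = family_lang (insert T \<T>')"
  have lang: "lang S \<subseteq> \<Sigma>" if "S \<in> insert T \<T>'" for S
    using that by (auto simp: \<Sigma>_def family_lang_def)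
  have "expand \<Sigma> T \<notin> expand \<Sigma> ` \<T>'"
    and app: "\<forall>\<phi>\<in>thms (expand \<Sigma> T). \<exists>S\<in>expand \<Sigma> ` \<T>'. \<phi> \<in> thms S"
    using T(2) by (auto simp: approximated_def \<Sigma>_def Let_def)
  moreover have "complete_theory S \<and> lang S = lang (expand \<Sigma> T)"
    if "S \<in> expand \<Sigma> ` \<T>'" for S
    using that lang \<T>' assms by (auto intro!: complete_theory_expand)
  moreover have "complete_theory (expand \<Sigma> T)"
    using T(1) lang by (simp add: complete_theory_expand)
  \<comment> \<open>Were this image finite, the separating sentence would contradict
    approximation.\<close>
  ultimately have inf: "infinite (expand \<Sigma> ` \<T>')"
    using finite_family_separated[of "expand \<Sigma> ` \<T>'" "expand \<Sigma> T"] by meson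
  \<comment> \<open>Members identified over the language of \<T> are identified over \<Sigma>, so
    the count over \<Sigma> bounds the other from below.\<close>
  have transfer: "expand \<Sigma> S = expand \<Sigma> S'"
    if "S \<in> \<T>'" "S' \<in> \<T>'" "expand (family_lang \<T>) S = expand (family_lang \<T>) S'" for S S'
    by (rule expand_eq_transfer[of _ _ "family_lang \<T>"])
      (use that lang \<T>' assms in \<open>auto simp: family_lang_def\<close>)
  have "infinite (expand (family_lang \<T>) ` \<T>')"
  proof
    assume "finite (expand (family_lang \<T>) ` \<T>')"
    then have "finite (expand \<Sigma> ` \<T>')"
      by (rule finite_image_transfer) (rule transfer)
    with inf show False ..
  qed
  moreover have "expand (family_lang \<T>) ` \<T>' \<subseteq> identified_family \<T>"
    using \<T>' by (auto simp: identified_family_def)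
  ultimately show "infinite (identified_family \<T>)"
    by (rule infinite_super[rotated])
next
  assume inf: "infinite (identified_family \<T>)"
  define \<Sigma> where "\<Sigma> = family_lang \<T>"
  have "complete_theory S \<and> lang S = \<Sigma>" if "S \<in> identified_family \<T>" for S
    using that assms
    by (auto simp: identified_family_def \<Sigma>_def family_lang_def intro!: complete_theory_expand)
  from infinite_family_accumulates[OF inf this] obtain M where M: "complete_theory (Theory \<Sigma> M)"
    and acc: "\<And>\<phi>. \<phi> \<in> M \<Longrightarrow> infinite {S \<in> identified_family \<T>. \<phi> \<in> thms S}"
    by blast
  define T where "T = Theory \<Sigma> M"
  \<comment> \<open>Dropping all members identified with the limit keeps it outside the
    subfamily.\<close>
  define \<T>' where "\<T>' = {T' \<in> \<T>. expand \<Sigma> T' \<noteq> T}"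
  \<comment> \<open>\<open>T\<close> carries all of \<Sigma>, so the common language is unchanged
    even if \<T>' has lost symbols.\<close>
  have \<Sigma>: "family_lang (insert T \<T>') = \<Sigma>"
    by (auto simp: family_lang_def T_def \<T>'_def \<Sigma>_def)
  have T: "expand \<Sigma> T = T"
    using expand_lang[OF M] by (simp add: T_def)
  have "\<exists>T'\<in>\<T>'. \<phi> \<in> thms (expand \<Sigma> T')" if "\<phi> \<in> thms T" for \<phi>
  proof -
    \<comment> \<open>At most one theory is removed, so a witness different from \<open>T\<close>
      remains.\<close>
    have "infinite ({S \<in> identified_family \<T>. \<phi> \<in> thms S} - {T})"
      using acc that by (simp add: T_def)
    then have "{S \<in> identified_family \<T>. \<phi> \<in> thms S} - {T} \<noteq> {}"
      by (metis finite.emptyI)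
    then obtain S where "S \<in> identified_family \<T>" "\<phi> \<in> thms S" "S \<noteq> T"
      by blast
    then show ?thesis
      by (auto simp: identified_family_def \<T>'_def \<Sigma>_def)
  qed
  moreover have "T \<notin> expand \<Sigma> ` \<T>'"
    by (auto simp: \<T>'_def)
  ultimately have "approximated \<T>' T"
    by (simp add: approximated_def \<Sigma> T)
  then show "\<exists>\<T>'. \<T>' \<subseteq> \<T> \<and> approximating_family \<T>'"
    using M by (intro exI[of _ \<T>']) (auto simp: approximating_family_def T_def \<T>'_def)
qed

end
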